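(* Let $X'$ be the simplicial complex with facets $1589,\ 1489,\ 1458,\ 1457,\ 4578$, let $A'$ be the subcomplex of $X'$ with facets $489,\ 589,\ 578,\ 157$, and let $Q'$ be the relative simplicial complex $Q'=(X',A')=X'\setminus A'$. Then $Q'$ has $f$-vector $(0,0,5,10,5)$, and $Q'$ is Cohen--Macaulay but not partitionable.
   Context: The notation $v_1\cdots v_k$ abbreviates the set $\{v_1,\dots,v_k\}$. A simplicial complex is a finite collection of subsets (faces) of a finite set closed under taking subsets; facets are maximal faces, and the complex with given facets consists of all subsets of those facets. $\dim\sigma=|\sigma|-1$ and $\dim\Delta$ is the maximum dimension of a face. A relative simplicial complex is a family $\Phi=(\Delta,\Gamma):=\Delta\setminus\Gamma$ with $\Gamma$ a subcomplex of a simplicial complex $\Delta$; its facets are its inclusion-maximal elements. Its $f$-vector is $(f_{-1},f_0,\dots,f_d)$, where $d$ is its dimension and $f_i$ is its number of $i$-dimensional faces. Link: $\mathrm{link}_\Delta(\sigma)=\{\tau\in\Delta : \tau\cap\sigma=\emptyset,\ \tau\cup\sigma\in\Delta\}$ if $\sigma\in\Delta$, and $\mathrm{link}_\Delta(\sigma)$ is the void complex (no faces at all) if $\sigma\notin\Delta$. A relative complex $\Phi=(\Delta,\Gamma)$ is Cohen--Macaulay if for every $\sigma\in\Delta$ (including $\emptyset$), $\tilde H_i(\mathrm{link}_\Delta(\sigma),\mathrm{link}_\Gamma(\sigma))=0$ for all $i<\dim\mathrm{link}_\Delta(\sigma)$, where $\tilde H_i$ denotes (reduced) relative simplicial homology with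 coefficients in $\mathbb{Z}$ (equal to the reduced homology of $\mathrm{link}_\Delta(\sigma)$ when $\mathrm{link}_\Gamma(\sigma)$ is void). A pure relative complex $\Phi$ (all facets of the same dimension) with facets $F_1,\dots,F_n$ is partitionable if there exist $R_1,\dots,R_n\in\Phi$ with $R_i\subseteq F_i$ such that $\Phi=\bigsqcup_{i=1}^n[R_i,F_i]$ (disjoint union), where $[R_i,F_i]=\{\sigma : R_i\subseteq\sigma\subseteq F_i\}$. *)

theory Defs
  imports
    "HOL-Library.Disjoint_Sets"
    "HOL-Algebra.Free_Abelian_Groups"
    "HOL-Algebra.Elementary_Groups"
begin

section \<open>Simplicial complexes and relative complexes\<close>

definition simplicial_complex :: "'a set set \<Rightarrow> bool" where
  "simplicial_complex \<Delta> \<longleftrightarrow>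
     finite \<Delta> \<and> (\<forall>\<sigma>\<in>\<Delta>. finite \<sigma>) \<and> (\<forall>\<sigma>\<in>\<Delta>. \<forall>\<tau>. \<tau> \<subseteq> \<sigma> \<longrightarrow> \<tau> \<in> \<Delta>)"

text \<open>
  A relative complex is presented by a pair of complexes: its homology and the Cohen-Macaulay
  property refer to the pair, while its facets, dimension, f-vector and partitionings refer
  to the family \<open>\<Delta> - \<Gamma>\<close> of its faces.  The void complex \<open>{}\<close> and the complex \<open>{{}}\<close> are
  different complexes.
\<close>

definition relative_complex :: "'a set set \<Rightarrow> 'a set set \<Rightarrow> bool" where
  "relative_complex \<Delta> \<Gamma> \<longleftrightarrow> simplicial_complex \<Delta> \<and> simplicial_complex \<Gamma> \<and> \<Gamma> \<subseteq> \<Delta>"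

definition complex_of :: "'a set set \<Rightarrow> 'a set set" where
  "complex_of \<F> = (\<Union>F\<in>\<F>. Pow F)"

definition facets :: "'a set set \<Rightarrow> 'a set set" where
  "facets \<Phi> = {F \<in> \<Phi>. \<forall>G\<in>\<Phi>. F \<subseteq> G \<longrightarrow> G = F}"

definition face_dim :: "'a set \<Rightarrow> int" where
  "face_dim \<sigma> = int (card \<sigma>) - 1"

text \<open>Only meaningful for nonempty families; \<open>complex_dim {{}} = - 1\<close>.\<close>

definition complex_dim :: "'a set set \<Rightarrow> int" where
  "complex_dim \<Phi> = Max (face_dim ` \<Phi>)"

definition faces_of_dim :: "int \<Rightarrow> 'a set set \<Rightarrow> 'a set set" where
  "faces_of_dim i \<Phi> = {\<sigma> \<in> \<Phi>. face_dim \<sigma> = i}"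

text \<open>The list \<open>[f\<^sub>-\<^sub>1, f\<^sub>0, \<dots>, f\<^sub>d]\<close> with \<open>d\<close> the dimension of \<open>\<Phi>\<close>.\<close>

definition f_vector :: "'a set set \<Rightarrow> nat list" where
  "f_vector \<Phi> = map (\<lambda>i. card (faces_of_dim i \<Phi>)) [-1..complex_dim \<Phi>]"

definition link :: "'a set set \<Rightarrow> 'a set \<Rightarrow> 'a set set" where
  "link \<Delta> \<sigma> = (if \<sigma> \<in> \<Delta> then {\<tau> \<in> \<Delta>. \<tau> \<inter> \<sigma> = {} \<and> \<tau> \<union> \<sigma> \<in> \<Delta>} else {})"


section \<open>Reduced relative simplicial homology with integer coefficients\<close>

text \<open>
  Every face is oriented by the order of its vertices.  The empty face generates the chains of
  dimension \<open>-1\<close>, so the boundary of a vertex is the empty face (the augmentation) and the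
  homology is reduced.
\<close>

definition simplicial_chain_group :: "int \<Rightarrow> 'a set set \<Rightarrow> ('a set \<Rightarrow>\<^sub>0 int) monoid" where
  "simplicial_chain_group i \<Delta> = free_Abelian_group (faces_of_dim i \<Delta>)"

definition face_boundary :: "'a::linorder set \<Rightarrow> 'a set \<Rightarrow>\<^sub>0 int" where
  "face_boundary \<sigma> =
     (\<Sum>v\<in>\<sigma>. frag_cmul ((-1) ^ card {u \<in> \<sigma>. u < v}) (frag_of (\<sigma> - {v})))"

definition simplicial_boundary :: "('a::linorder set \<Rightarrow>\<^sub>0 int) \<Rightarrow> 'a set \<Rightarrow>\<^sub>0 int" where
  "simplicial_boundary = frag_extend face_boundary"

text \<open>
  As for the singular relative homology groups of the library, the homology of the quotient
  complex \<open>C(\<Delta>) / C(\<Gamma>)\<close> is expressed inside \<open>C(\<Delta>)\<close>: relative cycles are the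
  chains of \<open>\<Delta>\<close> with boundary in \<open>\<Gamma>\<close>, and relative boundaries are the boundaries of chains
  of \<open>\<Delta>\<close> up to a chain of \<open>\<Gamma>\<close>.
\<close>

definition relative_cycles ::
    "int \<Rightarrow> 'a::linorder set set \<Rightarrow> 'a set set \<Rightarrow> ('a set \<Rightarrow>\<^sub>0 int) set" where
  "relative_cycles i \<Delta> \<Gamma> =
     {c \<in> carrier (simplicial_chain_group i \<Delta>).
        simplicial_boundary c \<in> carrier (simplicial_chain_group (i - 1) \<Gamma>)}"

definition relative_boundaries ::
    "int \<Rightarrow> 'a::linorder set set \<Rightarrow> 'a set set \<Rightarrow> ('a set \<Rightarrow>\<^sub>0 int) set" where
  "relative_boundaries i \<Delta> \<Gamma> =
     {simplicial_boundary b + g | b g.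
        b \<in> carrier (simplicial_chain_group (i + 1) \<Delta>) \<and>
        g \<in> carrier (simplicial_chain_group i \<Gamma>)}"

definition reduced_relative_homology ::
    "int \<Rightarrow> 'a::linorder set set \<Rightarrow> 'a set set \<Rightarrow> ('a set \<Rightarrow>\<^sub>0 int) set monoid" where
  "reduced_relative_homology i \<Delta> \<Gamma> =
     subgroup_generated (simplicial_chain_group i \<Delta>) (relative_cycles i \<Delta> \<Gamma>)
       Mod relative_boundaries i \<Delta> \<Gamma>"

definition cohen_macaulay :: "'a::linorder set set \<Rightarrow> 'a set set \<Rightarrow> bool" where
  "cohen_macaulay \<Delta> \<Gamma> \<longleftrightarrow>
     relative_complex \<Delta> \<Gamma> \<and>
     (\<forall>\<sigma>\<in>\<Delta>. \<forall>i < complex_dim (link \<Delta> \<sigma>).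
        trivial_group (reduced_relative_homology i (link \<Delta> \<sigma>) (link \<Gamma> \<sigma>)))"


section \<open>Partitionability\<close>

definition pure :: "'a set set \<Rightarrow> bool" where
  "pure \<Phi> \<longleftrightarrow> (\<forall>F\<in>facets \<Phi>. \<forall>G\<in>facets \<Phi>. face_dim F = face_dim G)"

text \<open>
  Applied to pure families only.  Purity is not part of the definition, so that the
  negation of \<open>partitionable\<close> never holds merely for lack of purity.  \<open>{R F..F}\<close> is the
  interval \<open>{\<sigma>. R F \<subseteq> \<sigma> \<and> \<sigma> \<subseteq> F}\<close> for inclusion.
\<close>

definition partitionable :: "'a set set \<Rightarrow> bool" where
  "partitionable \<Phi> \<longleftrightarrow>
     (\<exists>R. (\<forall>F\<in>facets \<Phi>. R F \<in> \<Phi> \<and> R F \<subseteq> F) \<and>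
          \<Phi> = (\<Union>F\<in>facets \<Phi>. {R F..F}) \<and>
          disjoint_family_on (\<lambda>F. {R F..F}) (facets \<Phi>))"


section \<open>The complexes \<open>X'\<close> and \<open>A'\<close>\<close>

definition X' :: "nat set set" where
  "X' = complex_of {{1,5,8,9}, {1,4,8,9}, {1,4,5,8}, {1,4,5,7}, {4,5,7,8}}"

definition A' :: "nat set set" where
  "A' = complex_of {{4,8,9}, {5,8,9}, {5,7,8}, {1,5,7}}"

definition Q' :: "nat set set" where
  "Q' = X' - A'"

lemma simplicial_complex_complex_of:
  assumes "finite \<F>" "\<And>F. F \<in> \<F> \<Longrightarrow> finite F"
  shows "simplicial_complex (complex_of \<F>)"
  using assms unfolding simplicial_complex_def complex_of_def
  by (auto intro: finite_subset)

lemma mem_complex_of: "\<sigma> \<in> complex_of \<F> \<longleftrightarrow> (\<exists>F\<in>\<F>. \<sigma> \<subseteq> F)"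
  by (auto simp: complex_of_def)

lemma complex_of_subset:
  assumes "\<forall>F\<in>\<F>. \<exists>G\<in>\<G>. F \<subseteq> G"
  shows "complex_of \<F> \<subseteq> complex_of \<G>"
  using assms by (meson mem_complex_of subsetI subset_trans)

lemma relative_complex_X'_A': "relative_complex X' A'"
proof -
  have "A' \<subseteq> X'"
    unfolding A'_def X'_def by (rule complex_of_subset) simp
  moreover have "simplicial_complex X'" "simplicial_complex A'"
    unfolding X'_def A'_def by (rule simplicial_complex_complex_of; auto)+
  ultimately show ?thesis
    by (simp add: relative_complex_def)
qed

lemma facets_complex_of:
  assumes "\<forall>F\<in>\<F>. \<forall>G\<in>\<F>. F \<subseteq> G \<longrightarrow> F = G"
  shows "facets (complex_of \<F>) = \<F>"
proof (intro equalityI subsetI)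
  fix F assume F: "F \<in> facets (complex_of \<F>)"
  then obtain G where G: "G \<in> \<F>" "F \<subseteq> G"
    by (auto simp: facets_def mem_complex_of)
  then have "G \<in> complex_of \<F>"
    by (auto simp: mem_complex_of)
  with F G show "F \<in> \<F>"
    by (auto simp: facets_def)
next
  fix F assume F: "F \<in> \<F>"
  have "G = F" if "G \<in> complex_of \<F>" "F \<subseteq> G" for G
  proof -
    obtain H where H: "H \<in> \<F>" "G \<subseteq> H"
      using \<open>G \<in> complex_of \<F>\<close> by (auto simp: mem_complex_of)
    then have "F = H"
      using assms F \<open>F \<subseteq> G\<close> by (meson subset_trans)
    then show ?thesis
      using H \<open>F \<subseteq> G\<close> by simp
  qed
  then show "F \<in> facets (complex_of \<F>)"
    using F by (auto simp: facets_def mem_complex_of)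
qed

lemma facets_X': "facets X' = {{1,5,8,9}, {1,4,8,9}, {1,4,5,8}, {1,4,5,7}, {4,5,7,8}}"
  unfolding X'_def by (rule facets_complex_of) simp

lemma facets_A': "facets A' = {{4,8,9}, {5,8,9}, {5,7,8}, {1,5,7}}"
  unfolding A'_def by (rule facets_complex_of) simp

lemma facets_Q': "facets Q' = facets X'"
proof (intro equalityI subsetI)
  have sub: "facets X' \<subseteq> Q'"
    unfolding facets_X' by (simp add: Q'_def X'_def A'_def mem_complex_of)
  have "Q' \<subseteq> X'"
    by (simp add: Q'_def)
  fix F
  {
    assume F: "F \<in> facets Q'"
    then have "F \<in> X'"
      using \<open>Q' \<subseteq> X'\<close> by (auto simp only: facets_def)
    then have "\<exists>G\<in>facets X'. F \<subseteq> G"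
      by (subst facets_X') (simp only: X'_def mem_complex_of)
    then obtain G where G: "G \<in> facets X'" "F \<subseteq> G"
      by (elim bexE)
    then have "G = F"
      using F subsetD[OF sub] by (simp add: facets_def)
    then show "F \<in> facets X'"
      using G by simp
  next
    assume F: "F \<in> facets X'"
    then have "F \<in> Q'"
      by (rule subsetD[OF sub])
    then show "F \<in> facets Q'"
      using F subsetD[OF \<open>Q' \<subseteq> X'\<close>] by (simp add: facets_def)
  }
qed

lemma pure_Q': "pure Q'"
  unfolding pure_def facets_Q' facets_X' by (simp add: face_dim_def)

end

(*
  Cohen-Macaulayness: if K arises from Gamma by successively adding pairs {s, s + v} of new faces
  all of whose other facets are already present (elementary expansions), then every relative
  homology group of (K, Gamma) vanishes.  The link of every face of X' is reached from the
  corresponding link of A' by expansions followed by the addition of faces of top dimension, which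
  do not affect the homology below the top dimension.

  Non-partitionability: an interval of a partition that contains one of the edges 18, 19, 45, 47
  must start at this edge.  Two intervals whose facets meet in 189 cannot start at 18 and 19, and
  those whose facets meet in 457 cannot start at 45 and 47.  This forces both 18 and 45 to be the
  bottom of the interval of 1458.
*)
theory Submission
  imports Defs
begin

section \<open>Relative homology\<close>

lemma mem_simplicial_chain_group:
  "c \<in> carrier (simplicial_chain_group i \<Delta>) \<longleftrightarrow> Poly_Mapping.keys c \<subseteq> faces_of_dim i \<Delta>"
  by (simp add: simplicial_chain_group_def)

lemma face_dim_Diff: "finite \<sigma> \<Longrightarrow> v \<in> \<sigma> \<Longrightarrow> face_dim (\<sigma> - {v}) = face_dim \<sigma> - 1"
  using card_Suc_Diff1[of \<sigma> v] by (simp add: face_dim_def)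

lemma keys_face_boundary: "Poly_Mapping.keys (face_boundary \<sigma>) \<subseteq> (\<lambda>v. \<sigma> - {v}) ` \<sigma>"
proof
  fix \<rho> assume "\<rho> \<in> Poly_Mapping.keys (face_boundary \<sigma>)"
  then have "\<exists>v\<in>\<sigma>. \<rho> \<in> Poly_Mapping.keys (frag_cmul ((-1) ^ card {u \<in> \<sigma>. u < v}) (frag_of (\<sigma> - {v})))"
    using keys_sum unfolding face_boundary_def by fast
  then show "\<rho> \<in> (\<lambda>v. \<sigma> - {v}) ` \<sigma>"
    by auto
qed

text \<open>Only the deletion of \<open>v\<close> turns \<open>insert v \<sigma>\<close> into
  \<open>\<sigma>\<close>, so a single summand survives. Its coefficient is a unit of the integers,
  which lets an expansion cancel the coefficient at \<open>\<sigma>\<close> without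
  division.\<close>

lemma lookup_face_boundary:
  assumes "finite \<sigma>" "v \<notin> \<sigma>"
  shows "poly_mapping.lookup (face_boundary (insert v \<sigma>)) \<sigma> = (-1) ^ card {u \<in> \<sigma>. u < v}"
proof -
  have *: "insert v \<sigma> - {w} = \<sigma> \<longleftrightarrow> w = v" if "w \<in> insert v \<sigma>" for w
    using that assms by auto
  have "poly_mapping.lookup (face_boundary (insert v \<sigma>)) \<sigma> =
      (\<Sum>w\<in>insert v \<sigma>. if w = v then (-1) ^ card {u \<in> insert v \<sigma>. u < w} else 0)"
    unfolding face_boundary_def lookup_sum lookup_frag_cmul lookup_frag_of
    by (rule sum.cong[OF refl]) (use * in auto)
  also have "\<dots> = (-1) ^ card {u \<in> insert v \<sigma>. u < v}"
    using assms by simp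
  also have "{u \<in> insert v \<sigma>. u < v} = {u \<in> \<sigma>. u < v}"
    by auto
  finally show ?thesis .
qed

lemma keys_simplicial_boundary:
  assumes "simplicial_complex \<Delta>" "Poly_Mapping.keys c \<subseteq> \<Delta>"
  shows "Poly_Mapping.keys (simplicial_boundary c) \<subseteq> \<Delta>"
proof -
  have face: "Poly_Mapping.keys (face_boundary \<sigma>) \<subseteq> \<Delta>" if "\<sigma> \<in> \<Delta>" for \<sigma>
  proof
    fix \<rho> assume "\<rho> \<in> Poly_Mapping.keys (face_boundary \<sigma>)"
    then have "\<rho> \<subseteq> \<sigma>"
      using keys_face_boundary by blast
    then show "\<rho> \<in> \<Delta>"
      using that assms(1) by (simp add: simplicial_complex_def)
  qed
  show ?thesis
    unfolding simplicial_boundary_def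
    by (rule subset_trans[OF keys_frag_extend]) (use assms(2) face in auto)
qed

lemma simplicial_boundary_chain:
  assumes "simplicial_complex \<Delta>" "c \<in> carrier (simplicial_chain_group i \<Delta>)"
  shows "simplicial_boundary c \<in> carrier (simplicial_chain_group (i - 1) \<Delta>)"
proof -
  have "Poly_Mapping.keys (face_boundary \<sigma>) \<subseteq> faces_of_dim (i - 1) \<Delta>"
    if "\<sigma> \<in> faces_of_dim i \<Delta>" for \<sigma>
  proof
    fix \<rho> assume "\<rho> \<in> Poly_Mapping.keys (face_boundary \<sigma>)"
    then obtain v where "v \<in> \<sigma>" "\<rho> = \<sigma> - {v}"
      using keys_face_boundary by blast
    then show "\<rho> \<in> faces_of_dim (i - 1) \<Delta>"
      using that assms(1) face_dim_Diff[of \<sigma> v] by (auto simp: faces_of_dim_def simplicial_complex_def)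
  qed
  then show ?thesis
    using assms(2) keys_frag_extend[of face_boundary c]
    unfolding mem_simplicial_chain_group simplicial_boundary_def by blast
qed

lemma simplicial_boundary_add: "simplicial_boundary (a + b) = simplicial_boundary a + simplicial_boundary b"
  and simplicial_boundary_diff: "simplicial_boundary (a - b) = simplicial_boundary a - simplicial_boundary b"
  and simplicial_boundary_cmul: "simplicial_boundary (frag_cmul n a) = frag_cmul n (simplicial_boundary a)"
  and simplicial_boundary_of: "simplicial_boundary (frag_of \<sigma>) = face_boundary \<sigma>"
  and simplicial_boundary_0: "simplicial_boundary 0 = 0"
  by (simp_all add: simplicial_boundary_def frag_extend_add frag_extend_diff frag_extend_cmul)

lemma simplicial_boundary_sum:
  "finite I \<Longrightarrow> simplicial_boundary (\<Sum>i\<in>I. g i) = (\<Sum>i\<in>I. simplicial_boundary (g i))"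
  by (induction I rule: finite_induct) (simp_all add: simplicial_boundary_0 simplicial_boundary_add)

section \<open>The boundary of a boundary vanishes\<close>

lemma card_less_Diff:
  fixes \<sigma> :: "'a::linorder set"
  assumes "finite \<sigma>" "v \<in> \<sigma>"
  shows "card {u \<in> \<sigma>. u < w} = card {u \<in> \<sigma> - {v}. u < w} + (if v < w then 1 else 0)"
proof (cases "v < w")
  case True
  then have "{u \<in> \<sigma>. u < w} = insert v {u \<in> \<sigma> - {v}. u < w}"
    using assms by auto
  then show ?thesis
    using True assms by simp
next
  case False
  then have "{u \<in> \<sigma>. u < w} = {u \<in> \<sigma> - {v}. u < w}"
    by auto
  then show ?thesis
    using False by simp
qed

text \<open>Each pair of vertices can be deleted in two orders. Deleting the smaller one first
  shifts the position of the larger by one, so the two terms have opposite signs and the double sum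
  equals its own negative.\<close>

lemma simplicial_boundary_face_boundary: "simplicial_boundary (face_boundary \<sigma>) = 0"
proof (cases "finite \<sigma>")
  \<comment> \<open>A sum over an infinite set is 0 by convention.\<close>
  case False
  then show ?thesis
    by (simp add: face_boundary_def simplicial_boundary_0)
next
  case True
  define s :: "'a \<Rightarrow> 'a set \<Rightarrow> int" where "s w \<rho> = (-1) ^ card {u \<in> \<rho>. u < w}" for w \<rho>
  \<comment> \<open>Setting the diagonal to 0 lets both sums range over all of
    \<open>\<sigma>\<close>, so that they can be swapped.\<close>
  define g where "g v w = (if w = v then 0 else frag_cmul (s v \<sigma> * s w (\<sigma> - {v})) (frag_of (\<sigma> - {v} - {w})))" for v w
  have inner: "face_boundary (\<sigma> - {v}) = (\<Sum>w\<in>\<sigma> - {v}. frag_cmul (s w (\<sigma> - {v})) (frag_of (\<sigma> - {v} - {w})))" for v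
    by (simp add: face_boundary_def s_def)
  have "simplicial_boundary (face_boundary \<sigma>) = (\<Sum>v\<in>\<sigma>. frag_cmul (s v \<sigma>) (face_boundary (\<sigma> - {v})))"
    unfolding face_boundary_def[of \<sigma>] s_def
    by (simp add: simplicial_boundary_sum True simplicial_boundary_cmul simplicial_boundary_of)
  also have "\<dots> = (\<Sum>v\<in>\<sigma>. \<Sum>w\<in>\<sigma> - {v}. g v w)"
    unfolding inner using True by (auto intro!: sum.cong simp: g_def frag_cmul_sum)
  also have "\<dots> = (\<Sum>v\<in>\<sigma>. \<Sum>w\<in>\<sigma>. g v w)"
    using True by (intro sum.cong sum.mono_neutral_left) (auto simp: g_def)
  finally have eq: "simplicial_boundary (face_boundary \<sigma>) = (\<Sum>v\<in>\<sigma>. \<Sum>w\<in>\<sigma>. g v w)" .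
  have anti: "g v w = - g w v" if "v \<in> \<sigma>" "w \<in> \<sigma>" for v w
  proof (cases "v = w")
    case False
    have "\<sigma> - {v} - {w} = \<sigma> - {w} - {v}"
      by blast
    moreover have sign: "s w \<sigma> = s w (\<sigma> - {v}) * (if v < w then - 1 else 1)" if "v \<in> \<sigma>" for v w
      unfolding s_def card_less_Diff[OF True that] by (simp only: power_add) simp
    moreover have "s v \<sigma> * s w (\<sigma> - {v}) = - (s w \<sigma> * s v (\<sigma> - {w}))"
      unfolding sign[OF that(1), of w] sign[OF that(2), of v]
      using False by (cases v w rule: linorder_cases) (auto dest: less_asym)
    ultimately show ?thesis
      using False by (simp add: g_def)
  qed (simp add: g_def)
  have "(\<Sum>v\<in>\<sigma>. \<Sum>w\<in>\<sigma>. g v w) = (\<Sum>w\<in>\<sigma>. \<Sum>v\<in>\<sigma>. g v w)"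
    by (rule sum.swap)
  also have "\<dots> = (\<Sum>w\<in>\<sigma>. \<Sum>v\<in>\<sigma>. - g w v)"
    by (intro sum.cong HOL.refl anti)
  also have "\<dots> = - (\<Sum>w\<in>\<sigma>. \<Sum>v\<in>\<sigma>. g w v)"
    by (simp only: sum_negf)
  finally have "poly_mapping.lookup (\<Sum>v\<in>\<sigma>. \<Sum>w\<in>\<sigma>. g v w) \<rho> = - poly_mapping.lookup (\<Sum>v\<in>\<sigma>. \<Sum>w\<in>\<sigma>. g v w) \<rho>" for \<rho>
    by (metis lookup_uminus)
  then show ?thesis
    unfolding eq by (intro poly_mapping_eqI) simp
qed

lemma simplicial_boundary_boundary: "simplicial_boundary (simplicial_boundary c) = 0"
proof -
  have "Poly_Mapping.keys c \<subseteq> UNIV"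
    by simp
  then show ?thesis
    by (induction c rule: frag_induction)
      (simp_all add: simplicial_boundary_0 simplicial_boundary_of simplicial_boundary_diff
        simplicial_boundary_face_boundary)
qed

section \<open>Relative cycles modulo relative boundaries\<close>

lemma relative_boundariesI:
  assumes "c = simplicial_boundary b + g"
    and "b \<in> carrier (simplicial_chain_group (i + 1) \<Delta>)" "g \<in> carrier (simplicial_chain_group i \<Gamma>)"
  shows "c \<in> relative_boundaries i \<Delta> \<Gamma>"
  using assms unfolding relative_boundaries_def by blast

text \<open>Ensures that \<open>subgroup_generated\<close> in the definition of homology adds no
  elements to the relative cycles.\<close>

lemma subgroup_relative_cycles:
  "subgroup (relative_cycles i \<Delta> \<Gamma>) (simplicial_chain_group i \<Delta>)"
proof -
  interpret group "simplicial_chain_group i \<Delta>"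
    by (simp add: simplicial_chain_group_def)
  show ?thesis
  proof (rule subgroupI)
    show "relative_cycles i \<Delta> \<Gamma> \<noteq> {}"
      by (auto simp: relative_cycles_def mem_simplicial_chain_group simplicial_boundary_0 intro!: exI[of _ 0])
  next
    fix a assume "a \<in> relative_cycles i \<Delta> \<Gamma>"
    then show "inv\<^bsub>simplicial_chain_group i \<Delta>\<^esub> a \<in> relative_cycles i \<Delta> \<Gamma>"
      by (simp add: relative_cycles_def simplicial_chain_group_def simplicial_boundary_def frag_extend_minus)
  next
    fix a b assume "a \<in> relative_cycles i \<Delta> \<Gamma>" "b \<in> relative_cycles i \<Delta> \<Gamma>"
    then show "a \<otimes>\<^bsub>simplicial_chain_group i \<Delta>\<^esub> b \<in> relative_cycles i \<Delta> \<Gamma>"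
      by (auto simp: relative_cycles_def simplicial_chain_group_def simplicial_boundary_add dest: subsetD[OF keys_add])
  qed (auto simp: relative_cycles_def)
qed

lemma relative_boundaries_subset_cycles:
  assumes "relative_complex \<Delta> \<Gamma>"
  shows "relative_boundaries i \<Delta> \<Gamma> \<subseteq> relative_cycles i \<Delta> \<Gamma>"
proof
  fix c assume "c \<in> relative_boundaries i \<Delta> \<Gamma>"
  then obtain b g where c: "c = simplicial_boundary b + g"
    and b: "b \<in> carrier (simplicial_chain_group (i + 1) \<Delta>)" and g: "g \<in> carrier (simplicial_chain_group i \<Gamma>)"
    by (auto simp: relative_boundaries_def)
  have "simplicial_boundary b \<in> carrier (simplicial_chain_group i \<Delta>)"
    using simplicial_boundary_chain[OF _ b] assms by (simp add: relative_complex_def)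
  moreover have "faces_of_dim i \<Gamma> \<subseteq> faces_of_dim i \<Delta>"
    using assms by (auto simp: relative_complex_def faces_of_dim_def)
  ultimately have "c \<in> carrier (simplicial_chain_group i \<Delta>)"
    using g keys_add[of "simplicial_boundary b" g] unfolding c mem_simplicial_chain_group by blast
  moreover have "simplicial_boundary c = simplicial_boundary g"
    by (simp add: c simplicial_boundary_add simplicial_boundary_boundary)
  moreover have "simplicial_boundary g \<in> carrier (simplicial_chain_group (i - 1) \<Gamma>)"
    using simplicial_boundary_chain[OF _ g] assms by (simp add: relative_complex_def)
  ultimately show "c \<in> relative_cycles i \<Delta> \<Gamma>"
    by (simp add: relative_cycles_def)
qed

lemma (in group) trivial_group_Mod_carrier: "trivial_group (G Mod carrier G)"
proof -
  have "r_coset G (carrier G) x = carrier G" if "x \<in> carrier G" for x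
    using that by (simp add: coset_join2 subgroup_self)
  moreover have "group (G Mod carrier G)"
    by (simp add: normal.factorgroup_is_group normal_self)
  ultimately show ?thesis
    unfolding trivial_group_def carrier_FactGroup using one_closed by auto
qed

text \<open>The reverse inclusion always holds, so the homology is the quotient of a group by
  itself. Vanishing is thus reduced to an inclusion of sets.\<close>

lemma trivial_reduced_relative_homology:
  assumes "relative_complex \<Delta> \<Gamma>" "relative_cycles i \<Delta> \<Gamma> \<subseteq> relative_boundaries i \<Delta> \<Gamma>"
  shows "trivial_group (reduced_relative_homology i \<Delta> \<Gamma>)"
proof -
  let ?G = "subgroup_generated (simplicial_chain_group i \<Delta>) (relative_cycles i \<Delta> \<Gamma>)"
  have "carrier ?G = relative_cycles i \<Delta> \<Gamma>"
    by (rule subgroup.carrier_subgroup_generated_subgroup[OF subgroup_relative_cycles])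
  also have "\<dots> = relative_boundaries i \<Delta> \<Gamma>"
    using assms relative_boundaries_subset_cycles by blast
  finally show ?thesis
    using group.trivial_group_Mod_carrier[of ?G]
    by (simp add: reduced_relative_homology_def simplicial_chain_group_def group.group_subgroup_generated)
qed

section \<open>Elementary expansions\<close>

text \<open>The inverse of an elementary collapse: \<open>\<sigma>\<close> becomes a free face of
  \<open>insert v \<sigma>\<close>. For empty \<open>\<sigma>\<close> the last condition is vacuous,
  so the void complex can expand to a single vertex with the empty face. This covers links of faces
  outside \<open>\<Gamma>\<close>.\<close>

inductive expands :: "'a set set \<Rightarrow> 'a set set \<Rightarrow> bool" for \<Gamma> where
  refl: "expands \<Gamma> \<Gamma>"
| step: "expands \<Gamma> K \<Longrightarrow> v \<notin> \<sigma> \<Longrightarrow> \<sigma> \<notin> K \<Longrightarrow> \<forall>u\<in>\<sigma>. insert v \<sigma> - {u} \<in> K \<Longrightarrow>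
    expands \<Gamma> (insert \<sigma> (insert (insert v \<sigma>) K))"

lemma expands_subset: "expands \<Gamma> K \<Longrightarrow> \<Gamma> \<subseteq> K"
  by (induction rule: expands.induct) auto

lemma finite_expansion_face:
  assumes "simplicial_complex K" "\<forall>u\<in>\<sigma>. insert v \<sigma> - {u} \<in> K"
  shows "finite \<sigma>"
proof (cases "\<sigma> = {}")
  case False
  then obtain u where "u \<in> \<sigma>"
    by auto
  then have "insert v \<sigma> - {u} \<in> K"
    using assms(2) by blast
  then have "finite (insert v \<sigma> - {u})"
    using assms(1) unfolding simplicial_complex_def by blast
  then show ?thesis
    by simp
qed simp

text \<open>A subset of \<open>insert v \<sigma>\<close> either contains \<open>\<sigma>\<close> and
  is one of the two new faces, or misses some \<open>u\<close> in \<open>\<sigma>\<close> and lies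
  in a face of \<open>K\<close>.\<close>

lemma simplicial_complex_expansion:
  assumes K: "simplicial_complex K" and v: "v \<notin> \<sigma>" and face: "\<forall>u\<in>\<sigma>. insert v \<sigma> - {u} \<in> K"
  shows "simplicial_complex (insert \<sigma> (insert (insert v \<sigma>) K))"
proof -
  have "\<tau> \<in> insert \<sigma> (insert (insert v \<sigma>) K)" if \<tau>: "\<tau> \<subseteq> insert v \<sigma>" for \<tau>
  proof (cases "\<sigma> \<subseteq> \<tau>")
    case True
    then show ?thesis
      using \<tau> by auto
  next
    case False
    then obtain u where "u \<in> \<sigma>" "u \<notin> \<tau>"
      by auto
    then have "insert v \<sigma> - {u} \<in> K" "\<tau> \<subseteq> insert v \<sigma> - {u}"
      using \<tau> face by auto
    then show ?thesis
      using K unfolding simplicial_complex_def by blast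
  qed
  moreover have "\<tau> \<in> K" if "\<tau> \<subseteq> \<rho>" "\<rho> \<in> K" for \<rho> \<tau>
    using that K unfolding simplicial_complex_def by blast
  moreover have "finite (insert \<sigma> (insert (insert v \<sigma>) K))" "\<forall>\<rho>\<in>insert \<sigma> (insert (insert v \<sigma>) K). finite \<rho>"
    using K finite_expansion_face[OF K face] by (auto simp: simplicial_complex_def)
  ultimately show ?thesis
    unfolding simplicial_complex_def by (metis insert_iff subset_insertI2)
qed

text \<open>
  A relative cycle \<open>c\<close> is first made zero at \<open>\<sigma>\<close> by subtracting a multiple of the boundary of
  \<open>insert v \<sigma>\<close>.  Then it is zero at \<open>insert v \<sigma>\<close> as well, because its boundary is zero at \<open>\<sigma>\<close> and
  no face of \<open>K\<close> contains \<open>\<sigma>\<close>.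
\<close>

lemma relative_cycles_expansion:
  fixes K :: "'a::linorder set set"
  assumes K: "simplicial_complex K" and "\<Gamma> \<subseteq> K" and v: "v \<notin> \<sigma>" and \<sigma>: "\<sigma> \<notin> K"
    and face: "\<forall>u\<in>\<sigma>. insert v \<sigma> - {u} \<in> K"
    and acyclic: "relative_cycles i K \<Gamma> \<subseteq> relative_boundaries i K \<Gamma>"
  defines "K' \<equiv> insert \<sigma> (insert (insert v \<sigma>) K)"
  shows "relative_cycles i K' \<Gamma> \<subseteq> relative_boundaries i K' \<Gamma>"
proof
  fix c assume "c \<in> relative_cycles i K' \<Gamma>"
  then have c: "Poly_Mapping.keys c \<subseteq> faces_of_dim i K'"
    and dc: "Poly_Mapping.keys (simplicial_boundary c) \<subseteq> faces_of_dim (i - 1) \<Gamma>"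
    by (auto simp: relative_cycles_def mem_simplicial_chain_group)
  define \<tau> where "\<tau> = insert v \<sigma>"
  define s :: int where "s = (-1) ^ card {u \<in> \<sigma>. u < v}"
  \<comment> \<open>Since \<open>s * s = 1\<close>, subtracting \<open>b\<close> times the boundary
    of \<open>\<tau>\<close> cancels the coefficient of \<open>c\<close> at
    \<open>\<sigma>\<close>.\<close>
  define b where "b = s * poly_mapping.lookup c \<sigma>"
  define c0 where "c0 = c - frag_cmul b (face_boundary \<tau>)"
  have fin: "finite \<sigma>"
    using K face by (rule finite_expansion_face)
  have K': "simplicial_complex K'"
    unfolding K'_def using K v face by (rule simplicial_complex_expansion)
  have ss: "s * s = 1"
    by (simp add: s_def flip: power_add)
  have lookup_\<tau>: "poly_mapping.lookup (face_boundary \<tau>) \<sigma> = s"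
    unfolding \<tau>_def s_def using fin v by (rule lookup_face_boundary)
  have "\<tau> \<noteq> \<sigma>"
    using v by (auto simp: \<tau>_def)
  \<comment> \<open>When \<open>b\<close> is 0 the chain below is zero and belongs to every chain
    group; otherwise \<open>\<sigma>\<close> occurs in \<open>c\<close>, which fixes the dimension
    of \<open>\<tau>\<close>.\<close>
  have "face_dim \<tau> = i + 1" if "b \<noteq> 0"
  proof -
    have "\<sigma> \<in> Poly_Mapping.keys c"
      using that by (auto simp: b_def in_keys_iff)
    then have "face_dim \<sigma> = i"
      using c by (auto simp: faces_of_dim_def)
    then show ?thesis
      using fin v by (simp add: face_dim_def \<tau>_def)
  qed
  then have b\<tau>: "frag_cmul b (frag_of \<tau>) \<in> carrier (simplicial_chain_group (i + 1) K')"
    by (auto simp: mem_simplicial_chain_group faces_of_dim_def K'_def \<tau>_def split: if_splits)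
  have "frag_cmul b (face_boundary \<tau>) \<in> carrier (simplicial_chain_group i K')"
    using simplicial_boundary_chain[OF K' b\<tau>] by (simp add: simplicial_boundary_cmul simplicial_boundary_of)
  then have c0: "Poly_Mapping.keys c0 \<subseteq> faces_of_dim i K'"
    using c keys_diff[of c "frag_cmul b (face_boundary \<tau>)"]
    unfolding c0_def mem_simplicial_chain_group by blast
  have "poly_mapping.lookup c0 \<sigma> = poly_mapping.lookup c \<sigma> - (s * s) * poly_mapping.lookup c \<sigma>"
    by (simp add: c0_def lookup_minus lookup_\<tau> b_def)
  then have c0_\<sigma>: "\<sigma> \<notin> Poly_Mapping.keys c0"
    by (simp add: ss in_keys_iff)
  have dc0: "simplicial_boundary c0 = simplicial_boundary c"
    by (simp add: c0_def simplicial_boundary_diff simplicial_boundary_cmul simplicial_boundary_face_boundary)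
  \<comment> \<open>Without its \<open>\<tau>\<close> term, \<open>c0\<close> is a chain of
    \<open>K\<close>, whose boundary misses \<open>\<sigma>\<close>. The coefficient of the boundary
    of \<open>c0\<close> at \<open>\<sigma>\<close> is therefore \<open>a * s\<close>, and it is 0
    because \<open>\<sigma>\<close> is not in \<open>\<Gamma>\<close>.\<close>
  define a where "a = poly_mapping.lookup c0 \<tau>"
  define c1 where "c1 = c0 - frag_cmul a (frag_of \<tau>)"
  have "\<tau> \<notin> Poly_Mapping.keys c1"
    by (simp add: c1_def a_def lookup_minus in_keys_iff)
  moreover have "Poly_Mapping.keys c1 \<subseteq> insert \<tau> (Poly_Mapping.keys c0)"
    using keys_diff[of c0 "frag_cmul a (frag_of \<tau>)"] by (auto simp: c1_def split: if_splits)
  ultimately have "Poly_Mapping.keys c1 \<subseteq> K"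
    using c0 c0_\<sigma> by (auto simp: K'_def \<tau>_def faces_of_dim_def)
  then have "poly_mapping.lookup (simplicial_boundary c1) \<sigma> = 0"
    using keys_simplicial_boundary[OF K] \<sigma> by (meson in_keys_iff subsetD)
  moreover have "poly_mapping.lookup (simplicial_boundary c0) \<sigma> = 0"
    using dc \<sigma> \<open>\<Gamma> \<subseteq> K\<close> unfolding dc0 by (auto simp: faces_of_dim_def in_keys_iff)
  ultimately have "a * s = 0"
    by (simp add: c1_def simplicial_boundary_diff simplicial_boundary_cmul simplicial_boundary_of lookup_minus lookup_\<tau>)
  then have "\<tau> \<notin> Poly_Mapping.keys c0"
    using ss by (auto simp: a_def in_keys_iff)
  then have "c0 \<in> relative_cycles i K \<Gamma>"
    using c0 c0_\<sigma> dc unfolding dc0[symmetric]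
    by (auto simp: relative_cycles_def mem_simplicial_chain_group faces_of_dim_def K'_def \<tau>_def)
  then obtain e g where e: "e \<in> carrier (simplicial_chain_group (i + 1) K)"
    and g: "g \<in> carrier (simplicial_chain_group i \<Gamma>)" and "c0 = simplicial_boundary e + g"
    using acyclic by (auto simp: relative_boundaries_def)
  then have "c = simplicial_boundary (e + frag_cmul b (frag_of \<tau>)) + g"
    by (simp add: c0_def simplicial_boundary_add simplicial_boundary_cmul simplicial_boundary_of algebra_simps)
  moreover have "e + frag_cmul b (frag_of \<tau>) \<in> carrier (simplicial_chain_group (i + 1) K')"
    using e b\<tau> keys_add[of e "frag_cmul b (frag_of \<tau>)"]
    unfolding mem_simplicial_chain_group by (auto simp: faces_of_dim_def K'_def)
  ultimately show "c \<in> relative_boundaries i K' \<Gamma>"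
    using g by (rule relative_boundariesI)
qed

text \<open>The induction starts at the pair of \<open>\<Gamma>\<close> with itself, where every
  cycle is a chain of \<open>\<Gamma>\<close> and hence a relative boundary with zero bounding
  chain.\<close>

lemma expands_acyclic:
  assumes "expands \<Gamma> K" "simplicial_complex \<Gamma>"
  shows "simplicial_complex K \<and> relative_cycles i K \<Gamma> \<subseteq> relative_boundaries i K \<Gamma>"
  using assms
proof (induction rule: expands.induct)
  case refl
  have "c \<in> relative_boundaries i \<Gamma> \<Gamma>" if "c \<in> relative_cycles i \<Gamma> \<Gamma>" for c
  proof -
    have "c = simplicial_boundary 0 + c" "0 \<in> carrier (simplicial_chain_group (i + 1) \<Gamma>)"
      by (simp_all add: simplicial_boundary_0 mem_simplicial_chain_group)
    moreover have "c \<in> carrier (simplicial_chain_group i \<Gamma>)"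
      using that by (simp add: relative_cycles_def)
    ultimately show ?thesis
      by (rule relative_boundariesI)
  qed
  then show ?case
    using refl by blast
next
  case (step K v \<sigma>)
  then have K: "simplicial_complex K" and acyclic: "relative_cycles i K \<Gamma> \<subseteq> relative_boundaries i K \<Gamma>"
    by blast+
  show ?case
    using simplicial_complex_expansion[OF K step.hyps(2,4)]
      relative_cycles_expansion[OF K expands_subset[OF step.hyps(1)] step.hyps(2-4) acyclic]
    by (rule conjI)
qed

text \<open>The faces outside \<open>K\<close> are too large to occur in an \<open>i\<close>-chain,
  so the relative cycles agree; additional faces of dimension \<open>i + 1\<close> can only enlarge
  the boundaries.\<close>

lemma trivial_reduced_relative_homology_expands:
  assumes "relative_complex \<Delta> \<Gamma>" "expands \<Gamma> K" "K \<subseteq> \<Delta>" "\<forall>\<rho>\<in>\<Delta> - K. i < face_dim \<rho>"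
  shows "trivial_group (reduced_relative_homology i \<Delta> \<Gamma>)"
proof (rule trivial_reduced_relative_homology[OF assms(1)])
  have "faces_of_dim i \<Delta> = faces_of_dim i K"
    using assms(3,4) by (auto simp: faces_of_dim_def)
  then have "relative_cycles i \<Delta> \<Gamma> = relative_cycles i K \<Gamma>"
    by (simp add: relative_cycles_def simplicial_chain_group_def)
  also have "\<dots> \<subseteq> relative_boundaries i K \<Gamma>"
    using expands_acyclic[OF assms(2)] assms(1) by (simp add: relative_complex_def)
  also have "\<dots> \<subseteq> relative_boundaries i \<Delta> \<Gamma>"
  proof
    fix c assume "c \<in> relative_boundaries i K \<Gamma>"
    then obtain b g where "c = simplicial_boundary b + g"
      "b \<in> carrier (simplicial_chain_group (i + 1) K)" "g \<in> carrier (simplicial_chain_group i \<Gamma>)"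
      unfolding relative_boundaries_def by blast
    moreover from this have "b \<in> carrier (simplicial_chain_group (i + 1) \<Delta>)"
      using assms(3) unfolding mem_simplicial_chain_group faces_of_dim_def by blast
    ultimately show "c \<in> relative_boundaries i \<Delta> \<Gamma>"
      by (intro relative_boundariesI)
  qed
  finally show "relative_cycles i \<Delta> \<Gamma> \<subseteq> relative_boundaries i \<Delta> \<Gamma>" .
qed

section \<open>Expansions computed from a list of candidates\<close>

definition try_expansion :: "'a set set \<Rightarrow> 'a set \<times> 'a \<Rightarrow> 'a set set \<Rightarrow> 'a set set" where
  "try_expansion \<Delta> = (\<lambda>(\<sigma>, v) K.
     if insert v \<sigma> \<in> \<Delta> \<and> v \<notin> \<sigma> \<and> \<sigma> \<notin> K \<and> (\<forall>u\<in>\<sigma>. insert v \<sigma> - {u} \<in> K)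
     then insert \<sigma> (insert (insert v \<sigma>) K) else K)"

text \<open>A pair that is not a legal expansion within \<open>\<Delta>\<close> is skipped, so every
  list yields a genuine sequence of expansions; the list only decides how far it reaches.\<close>

lemma expands_fold_try_expansion:
  assumes "simplicial_complex \<Delta>" "expands \<Gamma> K" "K \<subseteq> \<Delta>"
  shows "expands \<Gamma> (fold (try_expansion \<Delta>) ps K) \<and> fold (try_expansion \<Delta>) ps K \<subseteq> \<Delta>"
  using assms(2,3)
proof (induction ps arbitrary: K)
  case (Cons p ps)
  have "\<sigma> \<in> \<Delta>" if "insert v \<sigma> \<in> \<Delta>" for v \<sigma>
    using that assms(1) unfolding simplicial_complex_def by blast
  then have "expands \<Gamma> (try_expansion \<Delta> p K)" "try_expansion \<Delta> p K \<subseteq> \<Delta>"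
    using Cons.prems by (auto simp: try_expansion_def split: prod.split intro: expands.step)
  then show ?case
    by (simp add: Cons.IH)
qed simp

section \<open>Links and the greedy criterion\<close>

lemma simplicial_complex_link:
  assumes "simplicial_complex \<Delta>"
  shows "simplicial_complex (link \<Delta> \<sigma>)"
proof -
  have "\<tau> \<in> link \<Delta> \<sigma>" if "\<rho> \<in> link \<Delta> \<sigma>" "\<tau> \<subseteq> \<rho>" for \<rho> \<tau>
  proof -
    have \<rho>: "\<sigma> \<in> \<Delta>" "\<rho> \<in> \<Delta>" "\<rho> \<inter> \<sigma> = {}" "\<rho> \<union> \<sigma> \<in> \<Delta>"
      using that(1) by (simp_all add: link_def split: if_splits)
    moreover have "\<tau> \<inter> \<sigma> = {}" "\<tau> \<union> \<sigma> \<subseteq> \<rho> \<union> \<sigma>"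
      using \<rho>(3) that(2) by auto
    ultimately show ?thesis
      using that(2) assms unfolding simplicial_complex_def link_def by auto
  qed
  moreover have "link \<Delta> \<sigma> \<subseteq> \<Delta>"
    by (auto simp: link_def)
  ultimately show ?thesis
    using assms finite_subset[of "link \<Delta> \<sigma>" \<Delta>] unfolding simplicial_complex_def by blast
qed

lemma relative_complex_link: "relative_complex \<Delta> \<Gamma> \<Longrightarrow> relative_complex (link \<Delta> \<sigma>) (link \<Gamma> \<sigma>)"
  by (auto simp: relative_complex_def simplicial_complex_link) (auto simp: link_def split: if_splits)

text \<open>
  The constants below are kept separate so that \<open>code_simp\<close> normalises each link once, when it is
  passed as an argument, rather than at every occurrence and under binders.
\<close>

definition greedy_expansion :: "'a set list \<Rightarrow> 'a list \<Rightarrow> 'a set set \<Rightarrow> 'a set set \<Rightarrow> 'a set set" where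
  "greedy_expansion \<sigma>s vs \<Delta> =
     fold (try_expansion \<Delta>) [(\<sigma>, v). v \<leftarrow> vs, \<sigma> \<leftarrow> filter (\<lambda>\<sigma>. \<sigma> \<in> \<Delta>) \<sigma>s]"

text \<open>Faces of top dimension may be left over, since only homology strictly below that
  dimension has to vanish.\<close>

definition greedily_expandable :: "'a set list \<Rightarrow> 'a list \<Rightarrow> 'a set set \<Rightarrow> 'a set set \<Rightarrow> bool" where
  "greedily_expandable \<sigma>s vs \<Delta> \<Gamma> \<longleftrightarrow>
     (\<forall>\<rho>\<in>\<Delta> - greedy_expansion \<sigma>s vs \<Delta> \<Gamma>. complex_dim \<Delta> \<le> face_dim \<rho>)"

definition link_greedily_expandable ::
    "'a set list \<Rightarrow> 'a list \<Rightarrow> 'a set set \<Rightarrow> 'a set set \<Rightarrow> 'a set \<Rightarrow> bool" where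
  "link_greedily_expandable \<sigma>s vs \<Delta> \<Gamma> \<sigma> \<longleftrightarrow> greedily_expandable \<sigma>s vs (link \<Delta> \<sigma>) (link \<Gamma> \<sigma>)"

lemma trivial_reduced_relative_homology_greedy:
  assumes rel: "relative_complex \<Delta> \<Gamma>" and "greedily_expandable \<sigma>s vs \<Delta> \<Gamma>" and "i < complex_dim \<Delta>"
  shows "trivial_group (reduced_relative_homology i \<Delta> \<Gamma>)"
proof -
  have "expands \<Gamma> (greedy_expansion \<sigma>s vs \<Delta> \<Gamma>)" "greedy_expansion \<sigma>s vs \<Delta> \<Gamma> \<subseteq> \<Delta>"
    using rel expands_fold_try_expansion[OF _ expands.refl, of \<Delta> \<Gamma>]
    unfolding greedy_expansion_def relative_complex_def by blast+
  moreover have "\<forall>\<rho>\<in>\<Delta> - greedy_expansion \<sigma>s vs \<Delta> \<Gamma>. i < face_dim \<rho>"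
    using assms(2,3) unfolding greedily_expandable_def by (meson less_le_trans)
  ultimately show ?thesis
    by (rule trivial_reduced_relative_homology_expands[OF rel])
qed

lemma cohen_macaulay_if_links_greedily_expandable:
  assumes "relative_complex \<Delta> \<Gamma>" "Ball \<Delta> (link_greedily_expandable \<sigma>s vs \<Delta> \<Gamma>)"
  shows "cohen_macaulay \<Delta> \<Gamma>"
  unfolding cohen_macaulay_def
  using assms trivial_reduced_relative_homology_greedy[OF relative_complex_link[OF assms(1)]]
  by (auto simp: link_greedily_expandable_def)


section \<open>The relative complex \<open>Q'\<close>\<close>

text \<open>
  The list of sets must list every set after its subsets.  The list of vertices was found by computer
  search; no shorter one works for all links.
\<close>

lemma cohen_macaulay_X'_A': "cohen_macaulay X' A'"
proof (rule cohen_macaulay_if_links_greedily_expandable[OF relative_complex_X'_A'])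
  \<comment> \<open>\<open>subseqs\<close> lists longer subsequences before those contained in them,
    so \<open>rev\<close> produces the required order, starting with the empty set.\<close>
  show "Ball X' (link_greedily_expandable
      (map set (rev (subseqs [1, 4, 5, 7, 8, 9]))) [5, 7, 4, 9, 8, 1, 5] X' A')"
    by code_simp
qed

lemma not_partitionable_Q': "\<not> partitionable Q'"
proof
  assume "partitionable Q'"
  then obtain R where R: "\<And>F. F \<in> facets Q' \<Longrightarrow> R F \<in> Q' \<and> R F \<subseteq> F"
    and cover: "Q' = (\<Union>F\<in>facets Q'. {R F..F})"
    and disj: "disjoint_family_on (\<lambda>F. {R F..F}) (facets Q')"
    unfolding partitionable_def by blast
  have facets: "facets Q' = {{1,5,8,9}, {1,4,8,9}, {1,4,5,8}, {1,4,5,7}, {4,5,7,8}}"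
    by (simp only: facets_Q' facets_X')
  \<comment> \<open>The bottom of the interval that covers \<open>E\<close> is a face of
    \<open>Q'\<close> inside \<open>E\<close>, hence \<open>E\<close> itself by minimality.\<close>
  have edge: "\<exists>F\<in>facets Q'. E \<subseteq> F \<and> R F = E" if "E \<in> Q'" "\<forall>\<sigma>\<in>Q'. \<not> \<sigma> \<subset> E" for E
  proof -
    have "E \<in> (\<Union>F\<in>facets Q'. {R F..F})"
      using equalityD1[OF cover] that(1) by (rule subsetD)
    then obtain F where F: "F \<in> facets Q'" "E \<in> {R F..F}"
      by (rule UN_E)
    then have "R F \<subseteq> E" "E \<subseteq> F"
      by simp_all
    moreover have "R F = E"
      using \<open>R F \<subseteq> E\<close> R[OF F(1)] that(2) by blast
    ultimately show ?thesis
      using F(1) by blast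
  qed
  \<comment> \<open>Otherwise the union of the two bottoms would be a face common to both
    intervals.\<close>
  have conflict: "\<not> R F \<union> R G \<subseteq> F \<inter> G" if "F \<in> facets Q'" "G \<in> facets Q'" "F \<noteq> G" for F G
  proof
    assume "R F \<union> R G \<subseteq> F \<inter> G"
    then have "R F \<union> R G \<in> {R F..F} \<inter> {R G..G}"
      by simp
    then show False
      using disj that unfolding disjoint_family_on_def by blast
  qed
  have minimal: "\<forall>E\<in>{{1,8},{1,9},{4,5},{4,7}}. E \<in> Q' \<and> (\<forall>\<sigma>\<in>Q'. \<not> \<sigma> \<subset> E)"
    by code_simp
  have distinct: "{1,5,8,9::nat} \<noteq> {1,4,8,9} \<and> {1,4,5,7::nat} \<noteq> {4,5,7,8}"
    by code_simp
  \<comment> \<open>The alternatives here and below are the facets that contain the edge in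
    question.\<close>
  have "R {1,5,8,9} = {1,8} \<or> R {1,4,8,9} = {1,8} \<or> R {1,4,5,8} = {1,8}"
    using edge[of "{1,8}"] minimal unfolding facets by simp
  moreover have "R {1,5,8,9} = {1,9} \<or> R {1,4,8,9} = {1,9}"
    using edge[of "{1,9}"] minimal unfolding facets by simp
  moreover have "\<not> R {1,5,8,9} \<union> R {1,4,8,9} \<subseteq> {1,8,9}"
    using conflict[of "{1,5,8,9}" "{1,4,8,9}"] distinct unfolding facets by simp
  \<comment> \<open>One of the two facets through \<open>{1,8,9}\<close> starts at
    \<open>{1,9}\<close>, so neither can start at \<open>{1,8}\<close>: the other would conflict
    with it, and a facet has only one bottom.\<close>
  ultimately have R18: "R {1,4,5,8} = {1,8}"
    by (elim disjE) (simp_all add: doubleton_eq_iff)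
  have "R {1,4,5,8} = {4,5} \<or> R {1,4,5,7} = {4,5} \<or> R {4,5,7,8} = {4,5}"
    using edge[of "{4,5}"] minimal unfolding facets by simp
  moreover have "R {1,4,5,7} = {4,7} \<or> R {4,5,7,8} = {4,7}"
    using edge[of "{4,7}"] minimal unfolding facets by simp
  moreover have "\<not> R {1,4,5,7} \<union> R {4,5,7,8} \<subseteq> {4,5,7}"
    using conflict[of "{1,4,5,7}" "{4,5,7,8}"] distinct unfolding facets by simp
  \<comment> \<open>The same argument with \<open>{4,7}\<close> and \<open>{4,5}\<close> at the
    triangle \<open>{4,5,7}\<close>.\<close>
  ultimately have "R {1,4,5,8} = {4,5}"
    by (elim disjE) (simp_all add: doubleton_eq_iff)
  then show False
    using R18 by (simp add: doubleton_eq_iff)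
qed

theorem mainTheorem7:
  shows "f_vector Q' = [0, 0, 5, 10, 5] \<and> cohen_macaulay X' A' \<and> \<not> partitionable Q'"
proof (intro conjI)
  show "f_vector Q' = [0, 0, 5, 10, 5]"
    by code_simp
qed (rule cohen_macaulay_X'_A' not_partitionable_Q')+

end
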